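(* Let $E$ be a finite graph, let $T_E$ be its talented monoid, and let $n$ be a natural number. Then $\operatorname{udim}(T_E)=n$ if and only if there are $n$ pairwise disjoint, nonempty, connected, hereditary and saturated subsets $H_1,H_2,\dots,H_n$ of $E^0$ such that $\bigcup_{i=1}^n H_i$ is cofinal.
   Context: A graph $E=(E^0,E^1,r,s)$ is a directed graph with vertex set $E^0$, edge set $E^1$, and range and source maps $r,s:E^1\to E^0$; here $E^0$ and $E^1$ are finite. A vertex $v$ is regular if $s^{-1}(v)\ne\varnothing$ and finite, otherwise it is a sink. For vertices, $u\ge v$ means there is a finite directed path (possibly of length $0$) from $u$ to $v$. $H\subseteq E^0$ is hereditary if $s(e)\in H$ implies $r(e)\in H$ for all $e\in E^1$, and saturated if for every regular vertex $v$, $r(s^{-1}(v))\subseteq H$ implies $v\in H$. A hereditary subset $H$ is cofinal if every vertex $u\in E^0$ satisfies $u\ge v$ for some $v\in H$. A hereditary saturated subset $H$ is connected if any two nonempty hereditary saturated subsets $K,L\subseteq H$ satisfy $K\cap L\neq\varnothing$. The talented monoid $T_E$ is the commutative monoid generated by $\{v(i)\mid v\in E^0,i\in\mathbb Z\}$ subject to $v(i)=\sum_{e\in s^{-1}(v)}r(e)(i+1)$ for all $i\in\mathbb Z$ and all regular vertices $v$; $\mathbb Z$ acts by ${}^n v(i)=v(i+n)$. On a commutative monoid, $a\le b$ iff $b=a+c$ for some $c$. A $\mathbb Z$-order ideal of $T_E$ is a submonoid $I$ closed under the $\mathbb Z$-action and such that $x\in I$, $y\le x$ imply $y\in I$. Two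 $\mathbb Z$-order ideals $I,J$ are incomparable if for all nonzero $a\in I$, $b\in J$ neither $a\le b$ nor $b\le a$ (equivalently $I\cap J=\{0\}$). The uniform dimension is $\operatorname{udim}(T_E)=\sup\{k\mid T_E\text{ contains }k\text{ pairwise incomparable nonzero }\mathbb Z\text{-order ideals}\}$. *)

theory Defs
  imports
    "HOL-Library.Multiset"
    "HOL-Library.Extended_Nat"
    "HOL-Library.Disjoint_Sets"
    "HOL-Algebra.Group"
    "HOL-Algebra.Divisibility"
    "Graph_Theory.Digraph"
begin

text \<open>
  A finite graph is a \<^locale>\<open>fin_digraph\<close> (loops and parallel edges allowed), with
  \<^const>\<open>tail\<close> as the source map and \<^const>\<open>head\<close> as the range map; the relation
  \<open>u \<ge> v\<close> on vertices is \<^const>\<open>reachable\<close>.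
\<close>

section \<open>Sets of vertices\<close>

definition regular_vertex :: "('v, 'e) pre_digraph \<Rightarrow> 'v \<Rightarrow> bool" where
  "regular_vertex E v \<longleftrightarrow> v \<in> verts E \<and> out_arcs E v \<noteq> {} \<and> finite (out_arcs E v)"

definition hereditary :: "('v, 'e) pre_digraph \<Rightarrow> 'v set \<Rightarrow> bool" where
  "hereditary E H \<longleftrightarrow>
     H \<subseteq> verts E \<and> (\<forall>e\<in>arcs E. tail E e \<in> H \<longrightarrow> head E e \<in> H)"

definition saturated :: "('v, 'e) pre_digraph \<Rightarrow> 'v set \<Rightarrow> bool" where
  "saturated E H \<longleftrightarrow>
     H \<subseteq> verts E \<and> (\<forall>v. regular_vertex E v \<and> head E ` out_arcs E v \<subseteq> H \<longrightarrow> v \<in> H)"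

definition cofinal_vertices :: "('v, 'e) pre_digraph \<Rightarrow> 'v set \<Rightarrow> bool" where
  "cofinal_vertices E H \<longleftrightarrow> hereditary E H \<and> (\<forall>u\<in>verts E. \<exists>v\<in>H. u \<rightarrow>\<^sup>*\<^bsub>E\<^esub> v)"

definition hs_connected :: "('v, 'e) pre_digraph \<Rightarrow> 'v set \<Rightarrow> bool" where
  "hs_connected E H \<longleftrightarrow> hereditary E H \<and> saturated E H \<and>
     (\<forall>K L. K \<subseteq> H \<and> hereditary E K \<and> saturated E K \<and> K \<noteq> {} \<and>
            L \<subseteq> H \<and> hereditary E L \<and> saturated E L \<and> L \<noteq> {} \<longrightarrow> K \<inter> L \<noteq> {})"

section \<open>The talented monoid\<close>

text \<open>
  The monoid is the quotient of the free commutative monoid on \<open>verts E \<times> \<int>\<close>, whose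
  elements are the finite multisets over that set, by the least congruence containing the
  defining relations. The pair \<open>(v, i)\<close> is the generator \<open>v(i)\<close>.
\<close>

definition talented_free :: "('v, 'e) pre_digraph \<Rightarrow> ('v \<times> int) multiset set" where
  "talented_free E = {x. set_mset x \<subseteq> verts E \<times> UNIV}"

inductive_set talented_rel ::
  "('v, 'e) pre_digraph \<Rightarrow> (('v \<times> int) multiset \<times> ('v \<times> int) multiset) set"
  for E :: "('v, 'e) pre_digraph" where
  gen: "regular_vertex E v \<Longrightarrow>
     ({#(v, i)#}, image_mset (\<lambda>e. (head E e, i + 1)) (mset_set (out_arcs E v))) \<in> talented_rel E"
| refl: "x \<in> talented_free E \<Longrightarrow> (x, x) \<in> talented_rel E"
| sym: "(x, y) \<in> talented_rel E \<Longrightarrow> (y, x) \<in> talented_rel E"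
| trans: "(x, y) \<in> talented_rel E \<Longrightarrow> (y, z) \<in> talented_rel E \<Longrightarrow> (x, z) \<in> talented_rel E"
| add: "(x, y) \<in> talented_rel E \<Longrightarrow> (x', y') \<in> talented_rel E \<Longrightarrow>
     (x + x', y + y') \<in> talented_rel E"

abbreviation talented_class ::
  "('v, 'e) pre_digraph \<Rightarrow> ('v \<times> int) multiset \<Rightarrow> ('v \<times> int) multiset set" where
  "talented_class E x \<equiv> talented_rel E `` {x}"

text \<open>
  The library's monoids are written multiplicatively: \<open>\<otimes>\<close> is the sum of the talented
  monoid, \<open>\<one>\<close> its zero, and \<^const>\<open>factor\<close> (\<open>divides\<close>) its algebraic preorder
  \<open>\<le>\<close>.
\<close>

definition talented_monoid :: "('v, 'e) pre_digraph \<Rightarrow> ('v \<times> int) multiset set monoid" where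
  "talented_monoid E =
     \<lparr>carrier = talented_free E // talented_rel E,
      mult = (\<lambda>X Y. \<Union>x\<in>X. \<Union>y\<in>Y. talented_class E (x + y)),
      one = talented_class E {#}\<rparr>"

definition shift :: "int \<Rightarrow> ('v \<times> int) multiset \<Rightarrow> ('v \<times> int) multiset" where
  "shift n = image_mset (\<lambda>(v, i). (v, i + n))"

definition talented_action ::
  "('v, 'e) pre_digraph \<Rightarrow> int \<Rightarrow> ('v \<times> int) multiset set \<Rightarrow> ('v \<times> int) multiset set" where
  "talented_action E n X = (\<Union>x\<in>X. talented_class E (shift n x))"

section \<open>Order ideals and uniform dimension\<close>

definition z_order_ideal ::
  "('m, 'k) monoid_scheme \<Rightarrow> (int \<Rightarrow> 'm \<Rightarrow> 'm) \<Rightarrow> 'm set \<Rightarrow> bool" where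
  "z_order_ideal M act I \<longleftrightarrow> submonoid I M \<and>
     (\<forall>n. \<forall>x\<in>I. act n x \<in> I) \<and>
     (\<forall>x\<in>I. \<forall>y\<in>carrier M. y divides\<^bsub>M\<^esub> x \<longrightarrow> y \<in> I)"

definition incomparable :: "('m, 'k) monoid_scheme \<Rightarrow> 'm set \<Rightarrow> 'm set \<Rightarrow> bool" where
  "incomparable M I J \<longleftrightarrow>
     (\<forall>a\<in>I - {\<one>\<^bsub>M\<^esub>}. \<forall>b\<in>J - {\<one>\<^bsub>M\<^esub>}. \<not> a divides\<^bsub>M\<^esub> b \<and> \<not> b divides\<^bsub>M\<^esub> a)"

definition udim :: "('m, 'k) monoid_scheme \<Rightarrow> (int \<Rightarrow> 'm \<Rightarrow> 'm) \<Rightarrow> enat" where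
  "udim M act =
     Sup {enat k |k. \<exists>I. (\<forall>j<k. z_order_ideal M act (I j) \<and> I j \<noteq> {\<one>\<^bsub>M\<^esub>}) \<and>
                         (\<forall>i<k. \<forall>j<k. i \<noteq> j \<longrightarrow> incomparable M (I i) (I j))}"

section \<open>Well-definedness of the talented monoid and its action\<close>

lemma talented_rel_free:
  assumes "wf_digraph E" "(x, y) \<in> talented_rel E"
  shows "x \<in> talented_free E \<and> y \<in> talented_free E"
  using assms(2)
proof induction
  case (gen v i)
  then show ?case
    using assms(1) by (auto simp: regular_vertex_def talented_free_def wf_digraph.head_in_verts)
qed (auto simp: talented_free_def)

lemma talented_rel_shift: "(x, y) \<in> talented_rel E \<Longrightarrow> (shift n x, shift n y) \<in> talented_rel E"
proof (induction rule: talented_rel.induct)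
  case (gen v i)
  from talented_rel.gen[OF gen, of "i + n"] show ?case
    by (simp add: shift_def multiset.map_comp o_def algebra_simps)
next
  case (refl x)
  then show ?case by (intro talented_rel.refl) (auto simp: shift_def talented_free_def)
next
  case (trans x y z)
  then show ?case by (blast intro: talented_rel.trans)
next
  case (add x y x' y')
  then show ?case by (simp add: shift_def talented_rel.add)
qed (blast intro: talented_rel.sym)

lemma equiv_talented_rel: "wf_digraph E \<Longrightarrow> equiv (talented_free E) (talented_rel E)"
  by (intro equivI refl_onI symI transI)
    (auto intro: talented_rel.refl talented_rel.sym talented_rel.trans dest: talented_rel_free)

lemma talented_mult_class:
  assumes "wf_digraph E" "x \<in> talented_free E" "y \<in> talented_free E"
  shows "talented_class E x \<otimes>\<^bsub>talented_monoid E\<^esub> talented_class E y = talented_class E (x + y)"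
proof -
  have "talented_class E (x' + y') = talented_class E (x + y)"
    if "x' \<in> talented_class E x" "y' \<in> talented_class E y" for x' y'
    using that by (intro equiv_class_eq[OF equiv_talented_rel[OF assms(1)]])
      (auto intro: talented_rel.sym talented_rel.add)
  moreover have "x \<in> talented_class E x" "y \<in> talented_class E y"
    using assms(2,3) by (auto intro: talented_rel.refl)
  ultimately show ?thesis
    unfolding talented_monoid_def monoid.simps by blast
qed

lemma talented_action_class:
  assumes "wf_digraph E" "x \<in> talented_free E"
  shows "talented_action E n (talented_class E x) = talented_class E (shift n x)"
proof -
  have "talented_class E (shift n x') = talented_class E (shift n x)"
    if "x' \<in> talented_class E x" for x'
    using that by (intro equiv_class_eq[OF equiv_talented_rel[OF assms(1)]])
      (auto intro: talented_rel.sym talented_rel_shift)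
  moreover have "x \<in> talented_class E x"
    using assms(2) by (auto intro: talented_rel.refl)
  ultimately show ?thesis
    unfolding talented_action_def by blast
qed

lemma comm_monoid_talented:
  assumes "wf_digraph E"
  shows "comm_monoid (talented_monoid E)"
proof -
  have car: "carrier (talented_monoid E) = talented_class E ` talented_free E"
    by (auto simp: talented_monoid_def quotient_def)
  have one: "\<one>\<^bsub>talented_monoid E\<^esub> = talented_class E {#}"
    by (simp add: talented_monoid_def)
  have z: "{#} \<in> talented_free E"
    by (simp add: talented_free_def)
  have add: "x + y \<in> talented_free E" if "x \<in> talented_free E" "y \<in> talented_free E" for x y
    using that by (auto simp: talented_free_def)
  note m = talented_mult_class[OF assms]
  show ?thesis
  proof (rule comm_monoidI)
  qed (auto simp: car one z m add add_ac)
qed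

end

theory Submission
  imports Defs
begin

text \<open>
  The theorem reduces to a statement about vertex sets, because \<open>\<int>\<close>-order ideals of the
  talented monoid and hereditary saturated sets control each other. The generators occurring in
  a representative of an element are not determined by the element, but for a hereditary and
  saturated \<open>H\<close> the property that they all lie over \<open>H\<close> is: the defining relation replaces
  \<open>v(i)\<close> by the generators over the out-neighbours of \<open>v\<close>, and \<open>v \<in> H\<close> holds iff all these
  neighbours lie in \<open>H\<close>, one direction being heredity and the other saturation
  (\<open>talented_rel_over_iff\<close>). Hence the elements supported over \<open>H\<close> form an order ideal, and
  disjoint sets give incomparable ideals. Conversely, the vertices \<open>v\<close> with \<open>v(0)\<close> in an order
  ideal form a hereditary saturated set, and incomparable ideals give disjoint sets because no
  \<open>v(0)\<close> is zero. So the uniform dimension is the supremum of the sizes of families of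
  disjoint nonempty hereditary saturated sets (\<open>udim_eq_Sup_families\<close>).

  It remains to see that the families of largest size are those whose members are connected and
  whose union is cofinal. A member that is not connected can be split in two. If the union \<open>U\<close>
  is not cofinal, the set of all vertices that do not reach \<open>U\<close> is hereditary and saturated and
  can be added. Conversely, if the \<open>H\<^sub>i\<close> are connected with cofinal union, every nonempty
  hereditary set meets some \<open>H\<^sub>i\<close>, and two disjoint hereditary saturated sets cannot meet the
  same \<open>H\<^sub>i\<close>; by pigeonhole no family is larger (\<open>family_size_le\<close>).
\<close>

section \<open>Families of hereditary saturated sets\<close>

definition hs_family ::
  "('v, 'e) pre_digraph \<Rightarrow> 'i set \<Rightarrow> ('i \<Rightarrow> 'v set) \<Rightarrow> bool" where
  "hs_family E A H \<longleftrightarrow>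
     (\<forall>i\<in>A. H i \<noteq> {} \<and> hereditary E (H i) \<and> saturated E (H i)) \<and> disjoint_family_on H A"

lemma hereditary_Int: "hereditary E H \<Longrightarrow> hereditary E K \<Longrightarrow> hereditary E (H \<inter> K)"
  by (auto simp: hereditary_def)

lemma saturated_Int: "saturated E H \<Longrightarrow> saturated E K \<Longrightarrow> saturated E (H \<inter> K)"
  by (auto simp: saturated_def)

lemma hereditary_UN: "(\<And>i. i \<in> A \<Longrightarrow> hereditary E (H i)) \<Longrightarrow> hereditary E (\<Union>i\<in>A. H i)"
  unfolding hereditary_def by blast

context fin_digraph
begin

lemma hereditary_reachable:
  assumes "hereditary G H" "u \<rightarrow>\<^sup>* v" "u \<in> H"
  shows "v \<in> H"
  using assms(2,3)
proof (induction rule: reachable_induct)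
  case (step x y)
  then show ?case using assms(1) by (auto simp: hereditary_def arcs_ends_def arc_to_ends_def)
qed

text \<open>
  This set is what makes non-cofinal families extendable. It contains the hereditary closure of
  every vertex that does not reach \<open>U\<close>, but is saturated from the start.
\<close>

lemma hs_not_reaching:
  assumes U: "hereditary G U"
  defines "K \<equiv> {u \<in> verts G. \<forall>v\<in>U. \<not> u \<rightarrow>\<^sup>* v}"
  shows "hereditary G K" "saturated G K"
proof -
  have adj: "tail G e \<rightarrow>\<^bsub>G\<^esub> head G e" if "e \<in> arcs G" for e
    using that by (auto simp: arcs_ends_def arc_to_ends_def)
  show "hereditary G K"
    unfolding hereditary_def K_def using adj by (auto intro: adj_reachable_trans)
  have "v \<in> K" if reg: "regular_vertex G v" and nb: "head G ` out_arcs G v \<subseteq> K" for v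
  proof -
    have "\<not> v \<rightarrow>\<^sup>* w" if w: "w \<in> U" for w
    proof
      assume "v \<rightarrow>\<^sup>* w"
      then show False
      proof (cases rule: converse_reachable_cases)
        case base
        \<comment> \<open>A regular vertex of \<open>U\<close> has an out-neighbour in \<open>U\<close>, so that neighbour is not in \<open>K\<close>.\<close>
        obtain e where e: "e \<in> out_arcs G v" using reg unfolding regular_vertex_def by blast
        then have "head G e \<in> U" using U w base by (auto simp: hereditary_def)
        then show False using e nb by (fastforce simp: K_def)
      next
        case (step x)
        then have "x \<in> head G ` out_arcs G v"
          by (auto simp: arcs_ends_def arc_to_ends_def)
        then have "x \<in> K" using nb by blast
        then show False using step w by (simp add: K_def)
      qed
    qed
    then show ?thesis using reg by (auto simp: K_def regular_vertex_def)
  qed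
  then show "saturated G K" by (auto simp: saturated_def K_def)
qed

text \<open>
  Sending each \<open>K\<^sub>j\<close> to an \<open>H\<^sub>i\<close> that it meets is injective: if \<open>K\<^sub>j\<close> and \<open>K\<^sub>l\<close> met the same
  \<open>H\<^sub>i\<close>, the two intersections with \<open>H\<^sub>i\<close> would contradict its connectedness.
\<close>

lemma family_size_le:
  assumes H: "finite A" "\<And>i. i \<in> A \<Longrightarrow> hs_connected G (H i)"
    and cof: "cofinal_vertices G (\<Union>i\<in>A. H i)"
    and K: "hs_family G B K"
  shows "card B \<le> card A"
proof -
  have "\<exists>i\<in>A. K j \<inter> H i \<noteq> {}" if j: "j \<in> B" for j
  proof -
    obtain u where u: "u \<in> K j" "u \<in> verts G" "hereditary G (K j)"
      using K j by (fastforce simp: hs_family_def hereditary_def)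
    then obtain v i where "i \<in> A" "v \<in> H i" "u \<rightarrow>\<^sup>* v"
      using cof by (auto simp: cofinal_vertices_def)
    then show ?thesis using u hereditary_reachable by blast
  qed
  then obtain f where f: "\<And>j. j \<in> B \<Longrightarrow> f j \<in> A \<and> K j \<inter> H (f j) \<noteq> {}" by metis
  have "inj_on f B"
  proof (rule inj_onI, rule ccontr)
    fix j j' assume j: "j \<in> B" "j' \<in> B" "f j = f j'" "j \<noteq> j'"
    have con: "hs_connected G (H (f j))" using f H(2) j(1) by blast
    then have HH: "hereditary G (H (f j))" "saturated G (H (f j))"
      by (simp_all add: hs_connected_def)
    have KK: "hereditary G (K x \<inter> H (f j)) \<and> saturated G (K x \<inter> H (f j))" if "x \<in> B" for x
      using K that HH by (auto simp: hs_family_def intro: hereditary_Int saturated_Int)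
    have "K j \<inter> K j' = {}" using K j by (auto simp: hs_family_def disjoint_family_on_def)
    moreover have "(K j \<inter> H (f j)) \<inter> (K j' \<inter> H (f j)) \<noteq> {}"
      using con[unfolded hs_connected_def] KK[OF j(1)] KK[OF j(2)] f[OF j(1)] f[OF j(2)] j(3)
      by (metis inf_le2)
    ultimately show False by blast
  qed
  then show ?thesis using f H(1) by (meson card_inj_on_le image_subsetI)
qed

lemma hs_connected_if_maximal:
  assumes H: "hs_family G {..<n} H"
    and max: "\<And>K. \<not> hs_family G {..<Suc n} K"
    and i: "i < n"
  shows "hs_connected G (H i)"
proof (rule ccontr)
  assume "\<not> ?thesis"
  moreover have "hereditary G (H i)" "saturated G (H i)"
    using H i by (auto simp: hs_family_def)
  ultimately obtain K L where KL:
    "K \<subseteq> H i" "hereditary G K" "saturated G K" "K \<noteq> {}"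
    "L \<subseteq> H i" "hereditary G L" "saturated G L" "L \<noteq> {}" "K \<inter> L = {}"
    unfolding hs_connected_def by blast
  have "K \<inter> H j = {} \<and> L \<inter> H j = {}" if "j < n" "j \<noteq> i" for j
  proof -
    have "H i \<inter> H j = {}"
      using H i that by (auto simp: hs_family_def disjoint_family_on_def)
    then show ?thesis using KL(1,5) by blast
  qed
  then have "hs_family G {..<Suc n} (H(i := K, n := L))"
    using H KL i unfolding hs_family_def disjoint_family_on_def
    by (simp add: less_Suc_eq Ball_def Int_commute)
  then show False using max by blast
qed

lemma cofinal_if_maximal:
  assumes H: "hs_family G {..<n} H"
    and max: "\<And>K. \<not> hs_family G {..<Suc n} K"
  shows "cofinal_vertices G (\<Union>i<n. H i)"
proof -
  let ?U = "\<Union>i<n. H i"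
  let ?K = "{u \<in> verts G. \<forall>v\<in>?U. \<not> u \<rightarrow>\<^sup>* v}"
  have U: "hereditary G ?U" using H by (intro hereditary_UN) (auto simp: hs_family_def)
  have "?K = {}"
  proof (rule ccontr)
    assume "?K \<noteq> {}"
    moreover have "?K \<inter> H j = {}" if "j < n" for j using that by auto
    ultimately have "hs_family G {..<Suc n} (H(n := ?K))"
      using H hs_not_reaching[OF U] unfolding hs_family_def disjoint_family_on_def
      by (simp add: less_Suc_eq Ball_def Int_commute)
    then show False using max by blast
  qed
  then show ?thesis using U unfolding cofinal_vertices_def by blast
qed

end

section \<open>The vertices below an element of the talented monoid\<close>

text \<open>
  The basic invariant: membership of the support in a hereditary saturated set is a property of
  the congruence class, although the support itself is not.
\<close>

lemma talented_rel_over_iff: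
  assumes "(x, y) \<in> talented_rel E" and H: "hereditary E H" "saturated E H"
  shows "fst ` set_mset x \<subseteq> H \<longleftrightarrow> fst ` set_mset y \<subseteq> H"
  using assms(1)
proof induction
  case (gen v i)
  then have "v \<in> H \<longleftrightarrow> head E ` out_arcs E v \<subseteq> H"
    using H unfolding hereditary_def saturated_def by auto
  then show ?case using gen by (simp add: regular_vertex_def image_image)
qed auto

text \<open>
  The talented monoid is conical, and its generators are nonzero: each side of a defining
  relation is a nonempty sum.
\<close>

lemma talented_rel_empty_iff: "(x, y) \<in> talented_rel E \<Longrightarrow> x = {#} \<longleftrightarrow> y = {#}"
  by (induction rule: talented_rel.induct) (auto simp: regular_vertex_def mset_set_empty_iff)

context fin_digraph
begin

lemma carrier_talented: "carrier (talented_monoid G) = talented_class G ` talented_free G"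
  by (auto simp: talented_monoid_def quotient_def)

lemma one_talented: "\<one>\<^bsub>talented_monoid G\<^esub> = talented_class G {#}"
  by (simp add: talented_monoid_def)

lemma talented_class_eq_iff:
  assumes "x \<in> talented_free G" "y \<in> talented_free G"
  shows "talented_class G x = talented_class G y \<longleftrightarrow> (x, y) \<in> talented_rel G"
  using eq_equiv_class_iff[OF equiv_talented_rel[OF wf_digraph_axioms] assms] .

lemma talented_class_eq_one_iff:
  assumes "x \<in> talented_free G"
  shows "talented_class G x = \<one>\<^bsub>talented_monoid G\<^esub> \<longleftrightarrow> x = {#}"
proof -
  have "{#} \<in> talented_free G" by (simp add: talented_free_def)
  then show ?thesis
    using assms talented_class_eq_iff talented_rel_empty_iff talented_rel.refl
    unfolding one_talented by metis
qed

lemma talented_divides_iff: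
  assumes "x \<in> talented_free G" "y \<in> talented_free G"
  shows "talented_class G x divides\<^bsub>talented_monoid G\<^esub> talented_class G y \<longleftrightarrow>
    (\<exists>z\<in>talented_free G. (y, x + z) \<in> talented_rel G)"
proof -
  have "x + z \<in> talented_free G" if "z \<in> talented_free G" for z
    using that assms by (auto simp: talented_free_def)
  then show ?thesis
    using assms
    by (auto simp: factor_def carrier_talented talented_mult_class[OF wf_digraph_axioms]
        talented_class_eq_iff)
qed

subsection \<open>From hereditary saturated sets to order ideals\<close>

definition supported_ideal :: "'a set \<Rightarrow> ('a \<times> int) multiset set set" where
  "supported_ideal H = talented_class G ` {x \<in> talented_free G. fst ` set_mset x \<subseteq> H}"

lemma talented_class_in_supported_iff:
  assumes "hereditary G H" "saturated G H" "x \<in> talented_free G"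
  shows "talented_class G x \<in> supported_ideal H \<longleftrightarrow> fst ` set_mset x \<subseteq> H"
proof
  assume "talented_class G x \<in> supported_ideal H"
  then obtain y where "(x, y) \<in> talented_rel G" "fst ` set_mset y \<subseteq> H"
    using assms(3) by (auto simp: supported_ideal_def talented_class_eq_iff)
  then show "fst ` set_mset x \<subseteq> H" using talented_rel_over_iff[OF _ assms(1,2)] by blast
qed (use assms(3) in \<open>auto simp: supported_ideal_def\<close>)

lemma z_order_ideal_supported:
  assumes H: "hereditary G H" "saturated G H"
  shows "z_order_ideal (talented_monoid G) (talented_action G) (supported_ideal H)"
  unfolding z_order_ideal_def
proof (intro conjI allI ballI impI)
  note mem = talented_class_in_supported_iff[OF H]
  show "submonoid (supported_ideal H) (talented_monoid G)"
  proof
    show "supported_ideal H \<subseteq> carrier (talented_monoid G)"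
      by (auto simp: supported_ideal_def carrier_talented)
    show "\<one>\<^bsub>talented_monoid G\<^esub> \<in> supported_ideal H"
      by (auto simp: one_talented mem talented_free_def)
    fix a b assume "a \<in> supported_ideal H" "b \<in> supported_ideal H"
    then obtain x y where xy: "x \<in> talented_free G" "fst ` set_mset x \<subseteq> H" "a = talented_class G x"
      "y \<in> talented_free G" "fst ` set_mset y \<subseteq> H" "b = talented_class G y"
      by (auto simp: supported_ideal_def)
    moreover have "x + y \<in> talented_free G" using xy by (auto simp: talented_free_def)
    ultimately show "a \<otimes>\<^bsub>talented_monoid G\<^esub> b \<in> supported_ideal H"
      by (simp add: talented_mult_class[OF wf_digraph_axioms] mem image_Un)
  qed
  fix a assume "a \<in> supported_ideal H"
  then obtain x where x: "x \<in> talented_free G" "fst ` set_mset x \<subseteq> H" "a = talented_class G x"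
    by (auto simp: supported_ideal_def)
  have "shift n x \<in> talented_free G" "fst ` set_mset (shift n x) \<subseteq> H" for n
    using x by (auto simp: talented_free_def shift_def)
  then show "talented_action G n a \<in> supported_ideal H" for n
    using x by (simp add: talented_action_class[OF wf_digraph_axioms] mem)
  fix b assume "b \<in> carrier (talented_monoid G)" and dvd: "b divides\<^bsub>talented_monoid G\<^esub> a"
  then obtain y where y: "y \<in> talented_free G" "b = talented_class G y"
    by (auto simp: carrier_talented)
  then obtain z where "(x, y + z) \<in> talented_rel G"
    using dvd x by (auto simp: talented_divides_iff)
  then show "b \<in> supported_ideal H"
    using y x talented_rel_over_iff[OF _ H] by (auto simp: mem image_Un)
qed

lemma supported_ideal_nonzero:
  assumes H: "hereditary G H" "saturated G H" "H \<noteq> {}"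
  shows "supported_ideal H \<noteq> {\<one>\<^bsub>talented_monoid G\<^esub>}"
proof -
  obtain v where v: "v \<in> H" using H(3) by blast
  then have free: "{#(v, 0)#} \<in> talented_free G"
    using H(1) by (auto simp: talented_free_def hereditary_def)
  then have "talented_class G {#(v, 0)#} \<in> supported_ideal H"
    using v H by (simp add: talented_class_in_supported_iff)
  moreover have "talented_class G {#(v, 0)#} \<noteq> \<one>\<^bsub>talented_monoid G\<^esub>"
    using talented_class_eq_one_iff[OF free] by simp
  ultimately show ?thesis by auto
qed

lemma supported_ideals_disjoint:
  assumes H: "hereditary G H" "saturated G H" and K: "hereditary G K" "saturated G K"
    and disj: "H \<inter> K = {}"
  shows "supported_ideal H \<inter> supported_ideal K \<subseteq> {\<one>\<^bsub>talented_monoid G\<^esub>}"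
proof
  fix a assume a: "a \<in> supported_ideal H \<inter> supported_ideal K"
  then obtain x where x: "x \<in> talented_free G" "a = talented_class G x"
    by (auto simp: supported_ideal_def)
  with a have "fst ` set_mset x \<subseteq> H \<inter> K"
    by (simp add: talented_class_in_supported_iff[OF H] talented_class_in_supported_iff[OF K])
  then show "a \<in> {\<one>\<^bsub>talented_monoid G\<^esub>}"
    using disj x by (simp add: talented_class_eq_one_iff)
qed

end

text \<open>
  Order ideals are closed downwards, so two comparable elements, one in each ideal, put the
  smaller of them into both.
\<close>

lemma incomparable_if_trivial_Int:
  assumes "z_order_ideal M act I" "z_order_ideal M act J" "I \<inter> J \<subseteq> {\<one>\<^bsub>M\<^esub>}"
  shows "incomparable M I J"
proof -
  have carr: "I \<subseteq> carrier M" "J \<subseteq> carrier M"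
    using assms(1,2) submonoid.subset[of I M] submonoid.subset[of J M]
    by (simp_all add: z_order_ideal_def)
  have down: "b \<in> I' \<Longrightarrow> a \<in> carrier M \<Longrightarrow> a divides\<^bsub>M\<^esub> b \<Longrightarrow> a \<in> I'"
    if "z_order_ideal M act I'" for I' a b
    using that unfolding z_order_ideal_def by blast
  show ?thesis
    unfolding incomparable_def
    using carr down[OF assms(1)] down[OF assms(2)] assms(3) by (meson DiffE IntI in_mono)
qed

subsection \<open>From order ideals to hereditary saturated sets\<close>

context fin_digraph
begin

definition ideal_vertices :: "('a \<times> int) multiset set set \<Rightarrow> 'a set" where
  "ideal_vertices I = {v \<in> verts G. talented_class G {#(v, 0)#} \<in> I}"

context
  fixes I
  assumes I: "z_order_ideal (talented_monoid G) (talented_action G) I"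
begin

lemma ideal_below:
  assumes "talented_class G x \<in> I" "(x, y + z) \<in> talented_rel G"
  shows "talented_class G y \<in> I"
proof -
  have "x \<in> talented_free G" "y + z \<in> talented_free G"
    using talented_rel_free[OF wf_digraph_axioms assms(2)] by auto
  moreover from this have "y \<in> talented_free G" "z \<in> talented_free G"
    by (auto simp: talented_free_def)
  ultimately have "talented_class G y divides\<^bsub>talented_monoid G\<^esub> talented_class G x"
    "talented_class G y \<in> carrier (talented_monoid G)"
    using assms(2) by (auto simp: talented_divides_iff carrier_talented)
  then show ?thesis using I assms(1) by (simp add: z_order_ideal_def)
qed

lemma ideal_vertices_iff:
  assumes "v \<in> verts G"
  shows "v \<in> ideal_vertices I \<longleftrightarrow> talented_class G {#(v, i)#} \<in> I"
proof -
  have act: "talented_action G k (talented_class G {#(v, j)#}) = talented_class G {#(v, j + k)#}"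
    for j k
  proof -
    have "{#(v, j)#} \<in> talented_free G" using assms by (auto simp: talented_free_def)
    then show ?thesis by (simp add: talented_action_class[OF wf_digraph_axioms] shift_def)
  qed
  have "talented_class G {#(v, j + k)#} \<in> I" if "talented_class G {#(v, j)#} \<in> I" for j k
    using I that act[of k j] unfolding z_order_ideal_def by metis
  from this[of 0 i] this[of i "- i"] show ?thesis
    using assms by (auto simp: ideal_vertices_def)
qed

lemma ideal_contains_sum:
  assumes "\<And>v i. (v, i) \<in># x \<Longrightarrow> v \<in> ideal_vertices I"
  shows "talented_class G x \<in> I"
proof -
  have sub: "submonoid I (talented_monoid G)" using I by (simp add: z_order_ideal_def)
  from assms show ?thesis
  proof (induction x)
    case empty
    show ?case using submonoid.one_closed[OF sub] by (simp add: one_talented)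
  next
    case (add p x)
    obtain v i where p: "p = (v, i)" by fastforce
    have "v \<in> ideal_vertices I" using add.prems[of v i] p by simp
    then have "v \<in> verts G" "talented_class G {#p#} \<in> I"
      using ideal_vertices_iff p by (auto simp: ideal_vertices_def)
    moreover have "talented_class G x \<in> I" using add by auto
    moreover have "x \<in> talented_free G"
      using add.prems by (fastforce simp: talented_free_def ideal_vertices_def)
    moreover have "{#p#} \<in> talented_free G" using \<open>v \<in> verts G\<close> p by (simp add: talented_free_def)
    ultimately show ?case
      using submonoid.m_closed[OF sub, of "talented_class G {#p#}" "talented_class G x"]
      by (simp add: talented_mult_class[OF wf_digraph_axioms])
  qed
qed

lemma hereditary_ideal_vertices: "hereditary G (ideal_vertices I)"
  unfolding hereditary_def
proof (intro conjI ballI impI)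
  show "ideal_vertices I \<subseteq> verts G" by (auto simp: ideal_vertices_def)
  fix e assume e: "e \<in> arcs G" and v: "tail G e \<in> ideal_vertices I"
  let ?v = "tail G e" and ?g = "\<lambda>e. (head G e, 0 + 1 :: int)"
  have "regular_vertex G ?v" using e by (auto simp: regular_vertex_def)
  then have rel: "({#(?v, 0)#}, image_mset ?g (mset_set (out_arcs G ?v))) \<in> talented_rel G"
    by (rule talented_rel.gen)
  have "mset_set (out_arcs G ?v) = add_mset e (mset_set (out_arcs G ?v - {e}))"
    using e by (intro mset_set.remove) auto
  then have "image_mset ?g (mset_set (out_arcs G ?v)) =
      {#(head G e, 1)#} + image_mset ?g (mset_set (out_arcs G ?v - {e}))"
    by simp
  moreover have "talented_class G {#(?v, 0)#} \<in> I" using v by (simp add: ideal_vertices_def)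
  ultimately have "talented_class G {#(head G e, 1)#} \<in> I"
    using ideal_below rel by metis
  then show "head G e \<in> ideal_vertices I" using ideal_vertices_iff e by simp
qed

lemma saturated_ideal_vertices: "saturated G (ideal_vertices I)"
  unfolding saturated_def
proof (intro conjI allI impI)
  show "ideal_vertices I \<subseteq> verts G" by (auto simp: ideal_vertices_def)
  fix v assume v: "regular_vertex G v \<and> head G ` out_arcs G v \<subseteq> ideal_vertices I"
  let ?x = "image_mset (\<lambda>e. (head G e, 0 + 1 :: int)) (mset_set (out_arcs G v))"
  have rel: "({#(v, 0)#}, ?x) \<in> talented_rel G" using v by (intro talented_rel.gen) simp
  have "talented_class G ?x \<in> I"
    using v by (intro ideal_contains_sum) (auto simp: regular_vertex_def)
  moreover have "(?x, {#(v, 0)#} + {#}) \<in> talented_rel G"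
    using talented_rel.sym[OF rel] by simp
  ultimately have "talented_class G {#(v, 0)#} \<in> I" by (rule ideal_below)
  then show "v \<in> ideal_vertices I" using v by (simp add: ideal_vertices_def regular_vertex_def)
qed

text \<open>
  Every generator occurring in a nonzero element of \<open>I\<close> lies below that element.
\<close>

lemma ideal_vertices_nonempty:
  assumes "I \<noteq> {\<one>\<^bsub>talented_monoid G\<^esub>}"
  shows "ideal_vertices I \<noteq> {}"
proof -
  have sub: "submonoid I (talented_monoid G)" using I by (simp add: z_order_ideal_def)
  obtain a where a: "a \<in> I" "a \<noteq> \<one>\<^bsub>talented_monoid G\<^esub>"
    using assms submonoid.one_closed[OF sub] by blast
  then obtain x where x: "x \<in> talented_free G" "a = talented_class G x"
    using submonoid.subset[OF sub] by (auto simp: carrier_talented)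
  then have "x \<noteq> {#}" using a talented_class_eq_one_iff by blast
  then obtain v i y where y: "x = {#(v, i)#} + y"
    by (metis multi_nonempty_split surj_pair add_mset_add_single union_commute)
  then have "talented_class G {#(v, i)#} \<in> I"
    using ideal_below[of x "{#(v, i)#}" y] a x talented_rel.refl[OF x(1)] by simp
  moreover have "v \<in> verts G" using x y by (auto simp: talented_free_def)
  ultimately show ?thesis using ideal_vertices_iff by blast
qed

end

lemma ideal_vertices_disjoint:
  assumes "incomparable (talented_monoid G) I J"
  shows "ideal_vertices I \<inter> ideal_vertices J = {}"
proof (rule ccontr)
  assume "\<not> ?thesis"
  then obtain v where v: "v \<in> verts G"
    "talented_class G {#(v, 0)#} \<in> I" "talented_class G {#(v, 0)#} \<in> J"
    by (auto simp: ideal_vertices_def)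
  then have free: "{#(v, 0)#} \<in> talented_free G" by (simp add: talented_free_def)
  then have "talented_class G {#(v, 0)#} \<noteq> \<one>\<^bsub>talented_monoid G\<^esub>"
    using talented_class_eq_one_iff[OF free] by simp
  moreover have "talented_class G {#(v, 0)#} divides\<^bsub>talented_monoid G\<^esub> talented_class G {#(v, 0)#}"
  proof -
    have "{#} \<in> talented_free G" by (simp add: talented_free_def)
    then show ?thesis
      using free talented_rel.refl[OF free] by (auto simp: talented_divides_iff intro!: bexI[of _ "{#}"])
  qed
  ultimately show False using assms v unfolding incomparable_def by blast
qed

section \<open>The uniform dimension of a graph\<close>

lemma udim_eq_Sup_families:
  "udim (talented_monoid G) (talented_action G) =
     Sup {enat k |k. \<exists>H :: nat \<Rightarrow> 'a set. hs_family G {..<k} H}"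
proof -
  let ?M = "talented_monoid G" and ?act = "talented_action G"
  have "(\<exists>I. (\<forall>j<k. z_order_ideal ?M ?act (I j) \<and> I j \<noteq> {\<one>\<^bsub>?M\<^esub>}) \<and>
             (\<forall>i<k. \<forall>j<k. i \<noteq> j \<longrightarrow> incomparable ?M (I i) (I j))) \<longleftrightarrow>
        (\<exists>H :: nat \<Rightarrow> 'a set. hs_family G {..<k} H)" (is "?ideals \<longleftrightarrow> ?sets") for k :: nat
  proof
    assume ?ideals
    then obtain I :: "nat \<Rightarrow> ('a \<times> int) multiset set set" where
      I: "\<And>j. j < k \<Longrightarrow> z_order_ideal ?M ?act (I j) \<and> I j \<noteq> {\<one>\<^bsub>?M\<^esub>}"
      and inc: "\<And>i j. i < k \<Longrightarrow> j < k \<Longrightarrow> i \<noteq> j \<Longrightarrow> incomparable ?M (I i) (I j)"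
      by blast
    have "hs_family G {..<k} (\<lambda>j. ideal_vertices (I j))"
      unfolding hs_family_def disjoint_family_on_def
      using I inc ideal_vertices_nonempty hereditary_ideal_vertices saturated_ideal_vertices
        ideal_vertices_disjoint by (metis lessThan_iff)
    then show ?sets by blast
  next
    assume ?sets
    then obtain H :: "nat \<Rightarrow> 'a set" where H: "hs_family G {..<k} H" by blast
    have hs: "hereditary G (H j)" "saturated G (H j)" "H j \<noteq> {}" if "j < k" for j
      using H that by (auto simp: hs_family_def)
    have "incomparable ?M (supported_ideal (H i)) (supported_ideal (H j))"
      if "i < k" "j < k" "i \<noteq> j" for i j
    proof -
      have "H i \<inter> H j = {}"
        using H that by (auto simp: hs_family_def disjoint_family_on_def)
      with hs that show ?thesis
        by (intro incomparable_if_trivial_Int[where act = ?act] z_order_ideal_supported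
            supported_ideals_disjoint) auto
    qed
    then show ?ideals
      using z_order_ideal_supported[OF hs(1,2)] supported_ideal_nonzero[OF hs]
      by (intro exI[of _ "\<lambda>j. supported_ideal (H j)"]) simp
  qed
  then show ?thesis unfolding udim_def by simp
qed

end

text \<open>
  A finite supremum of a set of natural numbers is attained, since otherwise one less would
  still be an upper bound; the number \<open>0\<close> keeps the set nonempty.
\<close>

lemma Sup_enat_eq_enatD:
  assumes "Sup {enat k |k. P k} = enat n" "P 0"
  shows "P n" "\<not> P (Suc n)"
proof -
  have up: "k \<le> n" if "P k" for k
    using that assms(1) by (metis (mono_tags, lifting) Sup_upper enat_ord_simps(1) mem_Collect_eq)
  then show "\<not> P (Suc n)" by fastforce
  show "P n"
  proof (rule ccontr)
    assume "\<not> P n"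
    then have "n \<noteq> 0" using assms(2) by metis
    have "k \<le> n - 1" if "P k" for k
      using up[OF that] \<open>\<not> P n\<close> that by (cases "k = n") auto
    then have "Sup {enat k |k. P k} \<le> enat (n - 1)" by (intro Sup_least) auto
    then show False using assms(1) \<open>n \<noteq> 0\<close> by simp
  qed
qed

theorem theorem3p6:
  fixes E :: "('v, 'e) pre_digraph" and n :: nat
  assumes "fin_digraph E"
  shows "udim (talented_monoid E) (talented_action E) = enat n \<longleftrightarrow>
    (\<exists>H :: nat \<Rightarrow> 'v set.
       disjoint_family_on H {1..n} \<and>
       (\<forall>i\<in>{1..n}. H i \<noteq> {} \<and> hereditary E (H i) \<and> saturated E (H i) \<and> hs_connected E (H i)) \<and>
       cofinal_vertices E (\<Union>i\<in>{1..n}. H i))"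
proof -
  interpret fin_digraph E by fact
  let ?P = "\<lambda>k. \<exists>K :: nat \<Rightarrow> 'v set. hs_family E {..<k} K"
  have ivl: "{1..n} = Suc ` {..<n}"
    by (simp add: lessThan_atLeast0 image_Suc_atLeastLessThan atLeastLessThanSuc_atLeastAtMost)
  show ?thesis
  proof
    assume "udim (talented_monoid E) (talented_action E) = enat n"
    then have "Sup {enat k |k. ?P k} = enat n" by (simp add: udim_eq_Sup_families)
    moreover have "?P 0" by (simp add: hs_family_def disjoint_family_on_def)
    ultimately have "?P n" and max: "\<not> ?P (Suc n)" by (rule Sup_enat_eq_enatD)+
    then obtain K :: "nat \<Rightarrow> 'v set" where K: "hs_family E {..<n} K" by blast
    have "hs_connected E (K i)" if "i < n" for i
      using hs_connected_if_maximal[OF K] max that by blast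
    moreover have "cofinal_vertices E (\<Union>i<n. K i)"
      using cofinal_if_maximal[OF K] max by blast
    ultimately show "\<exists>H :: nat \<Rightarrow> 'v set.
       disjoint_family_on H {1..n} \<and>
       (\<forall>i\<in>{1..n}. H i \<noteq> {} \<and> hereditary E (H i) \<and> saturated E (H i) \<and> hs_connected E (H i)) \<and>
       cofinal_vertices E (\<Union>i\<in>{1..n}. H i)"
      using K unfolding ivl hs_family_def disjoint_family_on_def
      by (intro exI[of _ "\<lambda>i. K (i - 1)"]) auto
  next
    assume "\<exists>H :: nat \<Rightarrow> 'v set.
       disjoint_family_on H {1..n} \<and>
       (\<forall>i\<in>{1..n}. H i \<noteq> {} \<and> hereditary E (H i) \<and> saturated E (H i) \<and> hs_connected E (H i)) \<and>
       cofinal_vertices E (\<Union>i\<in>{1..n}. H i)"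
    then obtain H :: "nat \<Rightarrow> 'v set" where H: "hs_family E {1..n} H"
      and con: "\<And>i. i \<in> {1..n} \<Longrightarrow> hs_connected E (H i)"
      and cof: "cofinal_vertices E (\<Union>i\<in>{1..n}. H i)"
      unfolding hs_family_def by blast
    have "hs_family E {..<n} (\<lambda>i. H (Suc i))"
      using H unfolding hs_family_def disjoint_family_on_def ivl by auto
    then have "?P n" by blast
    moreover have "k \<le> n" if "?P k" for k
      using family_size_le[OF _ con cof] that by fastforce
    ultimately have "Sup {enat k |k. ?P k} = enat n"
      by (intro Sup_eqI) (force, blast)
    then show "udim (talented_monoid E) (talented_action E) = enat n"
      by (simp add: udim_eq_Sup_families)
  qed
qed

end
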